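(* Let $-\pi/2<\lambda<\pi/2$. The radius of $\lambda$-spirallikeness of the class $\mathcal{R}_\lambda$ of $\lambda$-Robertson functions is at least \[ R_{1}(\lambda)=\sup\{r<1 :\ Q_{\lambda}(rz)\prec P_{\lambda}(rz)\ \text{in } \mathbb{D}\}; \] that is, for every $f\in\mathcal{R}_\lambda$, \[ \operatorname{Re}\left(e^{-i\lambda}\frac{zf'(z)}{f(z)}\right)>0\quad\text{for all } |z|<R_{1}(\lambda). \]
   Context: $\mathbb{D}=\{z\in\mathbb{C}:|z|<1\}$. For analytic functions $g,G$ on $\mathbb{D}$, $g$ is subordinate to $G$ in $\mathbb{D}$, written $g\prec G$ or $g(z)\prec G(z)$, if there is an analytic function $\omega$ on $\mathbb{D}$ with $\omega(0)=0$, $|\omega(z)|<1$ and $g(z)=G(\omega(z))$ for all $z\in\mathbb{D}$. The subordination in the definition of $R_1(\lambda)$ includes the requirement that $z\mapsto Q_\lambda(rz)$ is analytic in $\mathbb{D}$ (with the removable singularity at $0$ removed), and the values $r$ there are in $(0,1)$. For $-\pi/2<\lambda<\pi/2$, $\mathcal{R}_\lambda$ (the $\lambda$-Robertson functions) is the set of analytic functions $f$ on $\mathbb{D}$ with $f(0)=0$, $f'(0)=1$ such that $P_f(z)=1+\dfrac{zf''(z)}{f'(z)}$ is analytic in $\mathbb{D}$ and $\operatorname{Re}\big(e^{-i\lambda}P_f(z)\big)>0$ for all $z\in\mathbb{D}$. The radius of $\lambda$-spirallikeness of $\mathcal{R}_\lambda$ is the supremum of $r\in(0,1]$ such that for every $f\in\mathcal{R}_\lambda$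 the function $zf'(z)/f(z)$ (with value $1$ at $z=0$) is analytic in $|z|<r$ and satisfies $\operatorname{Re}\big(e^{-i\lambda}zf'(z)/f(z)\big)>0$ there. Further, \[ P_{\lambda}(z)=\frac{1+e^{2i\lambda}z}{1-z},\qquad Q_{\lambda}(z)=\frac{e^{2i\lambda}z}{1-z-(1-z)^{1+e^{2i\lambda}}},\qquad Q_\lambda(0)=1, \] where the power of $1-z$ is taken with the principal branch (value $1$ at $z=0$). *)

theory Defs
  imports "HOL-Complex_Analysis.Complex_Analysis"
begin

definition subordinate :: "(complex \<Rightarrow> complex) \<Rightarrow> (complex \<Rightarrow> complex) \<Rightarrow> bool"
    (infix "\<prec>\<^sub>D" 50) where
  "g \<prec>\<^sub>D G \<longleftrightarrow>
     g holomorphic_on ball 0 1 \<and> G holomorphic_on ball 0 1 \<and>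
     (\<exists>\<omega>. \<omega> holomorphic_on ball 0 1 \<and> \<omega> 0 = 0 \<and>
        (\<forall>z\<in>ball 0 1. norm (\<omega> z) < 1 \<and> g z = G (\<omega> z)))"

definition convexity_fun :: "(complex \<Rightarrow> complex) \<Rightarrow> complex \<Rightarrow> complex" where
  "convexity_fun f z = 1 + z * deriv (deriv f) z / deriv f z"

text \<open>In \<open>Robertson\<close> and \<open>spirallike_radius\<close> below, analyticity of the quotient also carries the requirement that
  its denominator does not vanish (away from the origin): at a zero of the denominator the
  logarithmic derivative has a genuine pole, so the quotient is unbounded nearby and the convention
  \<open>x / 0 = 0\<close> cannot make it holomorphic there.\<close>

definition Robertson :: "real \<Rightarrow> (complex \<Rightarrow> complex) set" where
  "Robertson l =
     {f. f holomorphic_on ball 0 1 \<and> f 0 = 0 \<and> deriv f 0 = 1 \<and>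
         convexity_fun f holomorphic_on ball 0 1 \<and>
         (\<forall>z\<in>ball 0 1. Re (cis (- l) * convexity_fun f z) > 0)}"

definition starlike_fun :: "(complex \<Rightarrow> complex) \<Rightarrow> complex \<Rightarrow> complex" where
  "starlike_fun f z = (if z = 0 then 1 else z * deriv f z / f z)"

definition spirallike_radius :: "real \<Rightarrow> real" where
  "spirallike_radius l =
     Sup {r. 0 < r \<and> r \<le> 1 \<and>
            (\<forall>f\<in>Robertson l. starlike_fun f holomorphic_on ball 0 r \<and>
               (\<forall>z\<in>ball 0 r. Re (cis (- l) * starlike_fun f z) > 0))}"

definition P_fun :: "real \<Rightarrow> complex \<Rightarrow> complex" where
  "P_fun l z = (1 + cis (2 * l) * z) / (1 - z)"

definition Q_fun :: "real \<Rightarrow> complex \<Rightarrow> complex" where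
  "Q_fun l z =
     (if z = 0 then 1
      else cis (2 * l) * z / (1 - z - (1 - z) powr (1 + cis (2 * l))))"

text \<open>The analyticity condition on \<open>z \<mapsto> Q_fun l (r z)\<close> in the subordination likewise excludes zeros
  of the denominator of \<open>Q_fun\<close> in the punctured disc of radius \<open>r\<close>: these are poles, the
  numerator being nonzero.\<close>

definition R1 :: "real \<Rightarrow> real" where
  "R1 l = Sup {r. 0 < r \<and> r < 1 \<and>
             (\<lambda>z. Q_fun l (of_real r * z)) \<prec>\<^sub>D (\<lambda>z. P_fun l (of_real r * z))}"

end

theory Submission
  imports Defs
begin

text \<open>
  The idea is the Briot--Bouquet comparison of Miller and Mocanu.  For \<open>f\<close> in the class,
  \<open>p = z f'/f\<close> satisfies \<open>p + z p'/p = convexity_fun f\<close>, whose right-hand side is subordinate to \<open>P_fun l\<close>,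
  while \<open>q = Q_fun l\<close> satisfies \<open>q + z q'/q = P_fun l\<close>.  For \<open>r\<close> in the set defining \<open>R1 l\<close>, the value
  \<open>q w\<close> lies in the closed disc \<open>P_fun l ` cball 0 |w|\<close> for every \<open>|w| < r\<close>.  The claim is that \<open>p = q \<circ> \<phi>\<close> on
  \<open>|z| < r\<close> for some holomorphic \<open>\<phi>\<close> with \<open>|\<phi> z| \<le> |z|\<close>; then \<open>p z\<close> lies in \<open>P_fun l ` ball 0 r\<close>, which is
  contained in the half-plane.

  The bound \<open>|\<phi> z| \<le> |z|\<close> (\<open>subordination_modulus_bound\<close>) comes from Jack's lemma and convexity.
  If it failed, there would be a point where \<open>z \<phi>' = k \<phi>\<close> with \<open>k \<ge> 1\<close>, and there
  \<open>convexity_fun f z = q + k (P_fun l w - q)\<close> with \<open>w = \<phi> z\<close>, \<open>q = q w\<close>.  This point lies on the ray from \<open>q\<close>,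
  inside the convex disc of \<open>w\<close>, through the boundary point \<open>P_fun l w\<close>, at or beyond that
  boundary point, whereas \<open>convexity_fun f z\<close> is interior to that disc as \<open>|z| < |w|\<close>.

  The lift \<open>\<phi>\<close> exists because \<open>q\<close> is locally univalent.  The equality case of the Schwarz lemma
  shows that \<open>q\<close> has no critical points on \<open>|w| < r\<close> (\<open>admissible_radius_bounds\<close>), and the lift is continued
  from small discs to larger ones by a uniform factor, the bound on \<open>\<phi>\<close> keeping it inside a
  compact set (\<open>riccati_subordination\<close>).  To avoid possible poles of \<open>p\<close> and \<open>q\<close>, everything is
  done with the reciprocals \<open>u = 1/p\<close> and \<open>v = 1/q\<close>, which solve the linear equations
  \<open>z u' = 1 - u * convexity_fun f\<close> and \<open>z v' = 1 - v * P_fun l\<close>.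

  Since admissible radii exist (\<open>admissible_radii_nonempty\<close>), both claims about the supremum follow from the
  statement for each admissible radius (\<open>admissible_radius_spirallike\<close>).
\<close>

section \<open>Discs and the half-plane\<close>

text \<open>For \<open>M < 1\<close> the points with \<open>|w - a| < M |w - b|\<close> form an Apollonius disc.  Convexity is
  needed here with a strictness clause: a proper mixture of an interior point with a point of the
  closed disc is interior.  The reason is that \<open>|w - a|\<^sup>2 - M\<^sup>2 |w - b|\<^sup>2\<close> is a quadratic function of \<open>w\<close>
  with positive leading coefficient \<open>1 - M\<^sup>2\<close>, hence convex.\<close>

lemma norm_ratio_strictly_convex:
  fixes a b A q :: complex and M t :: real
  assumes M: "0 \<le> M" "M < 1"
    and A: "norm (A - a) < M * norm (A - b)"
    and q: "norm (q - a) \<le> M * norm (q - b)"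
    and t: "0 < t" "t \<le> 1"
  defines "w \<equiv> of_real t * A + of_real (1 - t) * q"
  shows "norm (w - a) < M * norm (w - b)"
proof -
  define g where "g = (\<lambda>x::complex. (norm (x - a))\<^sup>2 - M\<^sup>2 * (norm (x - b))\<^sup>2)"
  have id: "g w = t * g A + (1 - t) * g q - t * (1 - t) * (1 - M\<^sup>2) * (norm (A - q))\<^sup>2"
    unfolding g_def w_def cmod_power2 by (simp add: power2_eq_square algebra_simps)
  have gA: "g A < 0"
    using power_strict_mono[OF A, of 2] by (simp add: g_def power_mult_distrib)
  have gq: "g q \<le> 0"
    using power_mono[OF q, of 2] by (simp add: g_def power_mult_distrib)
  have M2: "M\<^sup>2 \<le> 1" using M by (simp add: power_le_one)
  have "t * g A < 0" using t gA by (simp add: mult_pos_neg)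
  moreover have "(1 - t) * g q \<le> 0" using t gq by (simp add: mult_nonneg_nonpos)
  moreover have "0 \<le> t * (1 - t) * (1 - M\<^sup>2) * (norm (A - q))\<^sup>2" using t M2 by simp
  ultimately have "g w < 0" using id by linarith
  then have "(norm (w - a))\<^sup>2 < (M * norm (w - b))\<^sup>2" by (simp add: g_def power_mult_distrib)
  then show ?thesis using M(1) by (meson mult_nonneg_nonneg norm_ge_zero power_less_imp_less_base)
qed

lemma one_plus_cis_double: "1 + cis (2 * l) = of_real (2 * cos l) * cis l"
proof (rule complex_eqI)
  show "Re (1 + cis (2 * l)) = Re (of_real (2 * cos l) * cis l)"
    by (simp add: cos_double_cos power2_eq_square)
  show "Im (1 + cis (2 * l)) = Im (of_real (2 * cos l) * cis l)"
    by (simp add: sin_double)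
qed

lemma one_plus_cis_double_nonzero: "cos l > 0 \<Longrightarrow> 1 + cis (2 * l) \<noteq> 0"
  by (simp add: one_plus_cis_double)

text \<open>Since \<open>1 + cis (2 l)\<close> is a positive multiple of \<open>cis l\<close>, the half-plane is the set of points
  closer to \<open>1\<close> than to the mirror image \<open>- cis (2 l)\<close> of \<open>1\<close> in its boundary line.  Shrinking the ratio
  of the two distances from \<open>1\<close> to \<open>c < 1\<close> gives the Apollonius discs inside the half-plane.\<close>

lemma half_plane_iff:
  assumes "cos l > 0"
  shows "Re (cis (- l) * w) > 0 \<longleftrightarrow> norm (w - 1) < norm (w + cis (2 * l))"
proof -
  have "(norm (w + cis (2 * l)))\<^sup>2 - (norm (w - 1))\<^sup>2 = 2 * Re (cnj (1 + cis (2 * l)) * w)"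
    unfolding cmod_power2 using sin_cos_squared_add[of "2*l"] by (simp add: power2_eq_square algebra_simps)
  also have "\<dots> = 4 * cos l * Re (cis (- l) * w)"
    unfolding one_plus_cis_double by (simp add: algebra_simps)
  finally have e: "(norm (w + cis (2 * l)))\<^sup>2 - (norm (w - 1))\<^sup>2 = 4 * cos l * Re (cis (- l) * w)" .
  have "norm (w - 1) < norm (w + cis (2 * l)) \<longleftrightarrow> (norm (w - 1))\<^sup>2 < (norm (w + cis (2 * l)))\<^sup>2"
    by (metis norm_ge_zero power_less_imp_less_base power_strict_mono zero_less_numeral)
  also have "\<dots> \<longleftrightarrow> 0 < 4 * cos l * Re (cis (- l) * w)" using e by linarith
  also have "\<dots> \<longleftrightarrow> Re (cis (- l) * w) > 0" using assms by (simp add: zero_less_mult_iff)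
  finally show ?thesis by simp
qed

lemma disc_imp_half_plane:
  assumes l: "cos l > 0" and c: "c < 1" and w: "norm (w - 1) \<le> c * norm (w + cis (2 * l))"
  shows "Re (cis (- l) * w) > 0"
proof -
  have "w + cis (2 * l) \<noteq> 0"
  proof
    assume a: "w + cis (2 * l) = 0"
    then have "w = 1" using w by simp
    then show False using a one_plus_cis_double_nonzero[OF l] by simp
  qed
  then have "c * norm (w + cis (2 * l)) < 1 * norm (w + cis (2 * l))"
    using c by (intro mult_strict_right_mono) auto
  then show ?thesis using w half_plane_iff[OF l] by simp
qed

text \<open>The ratio of these distances at \<open>P_fun l w\<close> is exactly \<open>|w|\<close>.  Thus \<open>P_fun l\<close> maps the disc of
  radius \<open>M\<close> onto the Apollonius disc of ratio \<open>M\<close>, and a bound on this ratio can stand for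
  subordination to \<open>P_fun l\<close> without naming the inner function.\<close>

lemma P_fun_ratio:
  assumes "w \<noteq> 1"
  shows "P_fun l w - 1 = w * (P_fun l w + cis (2 * l))"
    and "P_fun l w + cis (2 * l) = (1 + cis (2 * l)) / (1 - w)"
  using assms by (auto simp: P_fun_def field_simps)

section \<open>Jack's lemma and the comparison of two Riccati equations\<close>

text \<open>The core of Jack's lemma.  With \<open>L = z0 k'(z0) / k(z0)\<close>, moving from \<open>z0\<close> in a direction
  \<open>z0 d\<close> with \<open>Re d < 0\<close> enters the disc and changes \<open>k\<close> by the factor \<open>1 + L d\<close> to first order, so
  \<open>Re (L d) \<le> 0\<close> for all such \<open>d\<close>, which forces \<open>L\<close> to be real and nonnegative.\<close>

lemma real_derivative_at_max_modulus:
  fixes k :: "complex \<Rightarrow> complex"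
  assumes k: "k field_differentiable (at z0)" and nz: "k z0 \<noteq> 0"
    and mx: "\<And>z. norm z \<le> norm z0 \<Longrightarrow> norm (k z) \<le> norm (k z0)"
  obtains m where "0 \<le> m" "z0 * deriv k z0 = of_real m * k z0"
proof (cases "z0 = 0")
  case True
  then show thesis using that[of 0] by simp
next
  case z0: False
  define L where "L = z0 * deriv k z0 / k z0"
  have key: "Re (L * d) \<le> 0" if d: "Re d < 0" for d
  proof (rule ccontr)
    assume "\<not> Re (L * d) \<le> 0"
    then have pos: "Re (L * d) > 0" by simp
    define g where "g = (\<lambda>s::real. Re (k (z0 * (1 + of_real s * d)) / k z0))"
    have dk: "(k has_field_derivative deriv k z0) (at z0)"
      using k by (simp add: DERIV_deriv_iff_field_differentiable)
    have "((\<lambda>s. z0 * (1 + of_real s * d)) has_vector_derivative z0 * d) (at (0::real))"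
      by (auto intro!: derivative_eq_intros simp: has_vector_derivative_def scaleR_conv_of_real)
    then have "((k \<circ> (\<lambda>s. z0 * (1 + of_real s * d))) has_vector_derivative (z0 * d) * deriv k z0) (at (0::real))"
      by (intro field_vector_diff_chain_at) (use dk in auto)
    then have "((\<lambda>s. k (z0 * (1 + of_real s * d)) / k z0) has_vector_derivative ((z0 * d) * deriv k z0) / k z0) (at (0::real))"
      unfolding o_def by (rule has_vector_derivative_divide)
    then have "(g has_vector_derivative Re (((z0 * d) * deriv k z0) / k z0)) (at 0)"
      unfolding g_def by (rule bounded_linear.has_vector_derivative[OF bounded_linear_Re])
    then have "(g has_real_derivative Re (L * d)) (at 0)"
      by (simp add: has_real_derivative_iff_has_vector_derivative L_def mult_ac)
    from DERIV_pos_inc_right[OF this pos] obtain e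
      where e: "e > 0" "\<And>h. 0 < h \<Longrightarrow> h < e \<Longrightarrow> g 0 < g h" by auto
    have g0: "g 0 = 1" using nz by (simp add: g_def)
    have dn: "d \<noteq> 0" using d by auto
    define h where "h = min (e/2) (- Re d / (norm d)\<^sup>2)"
    have "0 < - Re d / (norm d)\<^sup>2" using d dn by (intro divide_pos_pos) auto
    then have h: "0 < h" "h < e" using e by (auto simp: h_def)
    have "h \<le> - Re d / (norm d)\<^sup>2" by (simp add: h_def)
    then have "h * (norm d)\<^sup>2 \<le> - Re d" using dn by (subst (asm) pos_le_divide_eq) auto
    then have "h * (2 * Re d + h * (norm d)\<^sup>2) \<le> 0" using h d by (intro mult_nonneg_nonpos) auto
    moreover have "(norm (1 + of_real h * d))\<^sup>2 = 1 + h * (2 * Re d + h * (norm d)\<^sup>2)"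
      unfolding cmod_power2 by (simp add: power2_eq_square algebra_simps)
    ultimately have "(norm (1 + of_real h * d))\<^sup>2 \<le> 1" by linarith
    then have "norm (1 + of_real h * d) \<le> 1" by (simp add: power2_le_iff_abs_le abs_square_le_1)
    then have "norm (z0 * (1 + of_real h * d)) \<le> norm z0"
      by (simp add: norm_mult mult_left_le)
    from mx[OF this] have "norm (k (z0 * (1 + of_real h * d)) / k z0) \<le> 1"
      using nz by (simp add: norm_divide)
    then have "g h \<le> 1" unfolding g_def using complex_Re_le_cmod order_trans by blast
    then show False using e(2)[OF h] g0 by simp
  qed
  have ineq: "- Re L - x * Im L \<le> 0" for x
    using key[of "Complex (-1) x"] by (simp add: algebra_simps)
  have "Im L = 0"
  proof (rule ccontr)
    assume "Im L \<noteq> 0"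
    then show False using ineq[of "(- Re L - 1) / Im L"] by simp
  qed
  then have "L = of_real (Re L)" by (intro complex_eqI) auto
  moreover have "Re L \<ge> 0" using ineq[of 0] by simp
  moreover have "z0 * deriv k z0 = L * k z0" using nz by (simp add: L_def)
  ultimately show thesis using that[of "Re L"] by metis
qed

text \<open>The Miller--Mocanu argument.  If \<open>|\<phi> z| \<le> |z|\<close> fails somewhere on a circle, let \<open>z0\<close> maximize
  \<open>|\<phi> z / z|\<close> on it and put \<open>w = \<phi> z0\<close>, so that \<open>|w| > |z0|\<close>.  Jack's lemma gives
  \<open>z0 \<phi>'(z0) = (1 + m) w\<close> with \<open>m \<ge> 0\<close>.  With \<open>q = 1 / v w\<close>, the two equations then say
  \<open>q - A z0 = (1 + m) (q - P_fun l w)\<close>, so \<open>P_fun l w\<close> lies on the segment from \<open>A z0\<close> to \<open>q\<close> and differs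
  from \<open>q\<close> unless the segment is degenerate.  But \<open>A z0\<close> is interior to the Apollonius disc of ratio
  \<open>|w|\<close>, \<open>q\<close> lies in its closure, and \<open>P_fun l w\<close> on its boundary: a contradiction to convexity.\<close>

lemma subordination_modulus_bound:
  fixes u v \<phi> A :: "complex \<Rightarrow> complex"
  assumes l: "cos l > 0" and r: "r \<le> 1"
    and v: "v holomorphic_on ball 0 r"
    and vnz: "\<And>w. w \<in> ball 0 r \<Longrightarrow> v w \<noteq> 0"
    and vbound: "\<And>w. w \<in> ball 0 r \<Longrightarrow> norm (1 / v w - 1) \<le> norm w * norm (1 / v w + cis (2 * l))"
    and vode: "\<And>w. w \<in> ball 0 r \<Longrightarrow> w * deriv v w = 1 - v w * P_fun l w"
    and u: "u holomorphic_on ball 0 \<rho>"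
    and uode: "\<And>z. z \<in> ball 0 \<rho> \<Longrightarrow> z * deriv u z = 1 - u z * A z"
    and Abound: "\<And>z. z \<in> ball 0 \<rho> \<Longrightarrow> norm (A z - 1) \<le> norm z * norm (A z + cis (2 * l))"
    and phi: "\<phi> holomorphic_on ball 0 \<rho>" "\<phi> 0 = 0"
    and phir: "\<And>z. z \<in> ball 0 \<rho> \<Longrightarrow> \<phi> z \<in> ball 0 r"
    and lift: "\<And>z. z \<in> ball 0 \<rho> \<Longrightarrow> v (\<phi> z) = u z"
    and z1: "z1 \<in> ball 0 \<rho>"
  shows "norm (\<phi> z1) \<le> norm z1"
proof (rule ccontr)
  assume neg: "\<not> norm (\<phi> z1) \<le> norm z1"
  define s where "s = norm z1"
  have s: "0 < s" "s < \<rho>" using neg phi(2) z1 by (auto simp: s_def)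
  \<comment> \<open>Jack's lemma is applied to \<open>\<phi> z / z\<close> because the maximum principle then also covers the centre.\<close>
  define k where "k = (\<lambda>z. if z = 0 then deriv \<phi> 0 else (\<phi> z - \<phi> 0) / (z - 0))"
  have k: "k holomorphic_on ball 0 \<rho>"
    unfolding k_def by (rule pole_lemma[OF phi(1)]) (use s in auto)
  have phik: "\<phi> z = z * k z" for z by (simp add: k_def phi(2))
  have sub: "cball 0 s \<subseteq> ball (0::complex) \<rho>" using s by auto
  have kc: "continuous_on (cball 0 s) (\<lambda>z. norm (k z))"
    using holomorphic_on_imp_continuous_on[OF holomorphic_on_subset[OF k sub]]
    by (intro continuous_intros) auto
  have z1s: "z1 \<in> sphere 0 s" by (simp add: s_def)
  obtain z0 where z0: "z0 \<in> sphere 0 s" and z0max: "\<And>z. z \<in> sphere 0 s \<Longrightarrow> norm (k z) \<le> norm (k z0)"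
    using continuous_attains_sup[of "sphere 0 s" "\<lambda>z. norm (k z)"] z1s
      continuous_on_subset[OF kc, of "sphere 0 s"] by auto
  have nz0: "norm z0 = s" "z0 \<in> ball 0 \<rho>" "z0 \<noteq> 0" using z0 s by auto
  have k1: "norm (k z0) > 1"
  proof -
    have "norm (k z1) > 1" using neg s unfolding phik by (simp add: norm_mult s_def)
    then show ?thesis using z0max[OF z1s] by linarith
  qed
  have kmax: "norm (k z) \<le> norm (k z0)" if "norm z \<le> norm z0" for z
  proof (rule maximum_modulus_frontier[of k "cball 0 s"])
    show "k holomorphic_on interior (cball 0 s)"
      by (rule holomorphic_on_subset[OF k]) (use s in auto)
    show "continuous_on (closure (cball 0 s)) k"
      using holomorphic_on_imp_continuous_on[OF holomorphic_on_subset[OF k sub]] by simp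
    show "norm (k z) \<le> norm (k z0)" if "z \<in> frontier (cball 0 s)" for z
      using that z0max by (simp add: frontier_cball)
  qed (use that nz0 in auto)
  have kd: "(k has_field_derivative deriv k z0) (at z0)"
    using k nz0 by (simp add: holomorphic_derivI)
  obtain m where m: "0 \<le> m" "z0 * deriv k z0 = of_real m * k z0"
    using real_derivative_at_max_modulus[of k z0] kmax kd k1
    by (metis field_differentiable_def norm_zero not_one_less_zero)
  have "((\<lambda>z. z * k z) has_field_derivative (k z0 + z0 * deriv k z0)) (at z0)"
    using kd by (auto intro!: derivative_eq_intros)
  then have phid: "(\<phi> has_field_derivative of_real (1 + m) * k z0) (at z0)"
    unfolding phik[abs_def, symmetric] by (simp add: m(2) algebra_simps phik)
  define w q B where "w = \<phi> z0" and "q = 1 / v w" and "B = P_fun l w"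
  have w: "w \<in> ball 0 r" using phir[OF nz0(2)] by (simp add: w_def)
  have "(v \<circ> \<phi> has_field_derivative deriv v w * (of_real (1 + m) * k z0)) (at z0)"
    by (rule DERIV_chain[OF _ phid]) (use v w in \<open>auto simp: w_def[symmetric] intro: holomorphic_derivI\<close>)
  then have "(u has_field_derivative deriv v w * (of_real (1 + m) * k z0)) (at z0)"
    by (rule has_field_derivative_transform_within_open[of _ _ _ "ball 0 \<rho>"]) (use nz0 lift in auto)
  then have "deriv u z0 = deriv v w * (of_real (1 + m) * k z0)" by (rule DERIV_imp_deriv)
  then have "z0 * deriv u z0 = of_real (1 + m) * (w * deriv v w)"
    by (simp add: w_def phik)
  then have eq: "1 - v w * A z0 = of_real (1 + m) * (1 - v w * B)"
    using uode[OF nz0(2)] vode[OF w] lift[OF nz0(2)] by (simp add: w_def[symmetric] B_def)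
  have vw: "v w \<noteq> 0" using vnz[OF w] .
  define t where "t = 1 / (1 + m)"
  have t: "0 < t" "t \<le> 1" using m by (auto simp: t_def)
  have m1: "complex_of_real (1 + m) \<noteq> 0"
    using m(1) by (metis add_nonneg_eq_0_iff of_real_eq_0_iff zero_le_one zero_neq_one)
  have "B = of_real t * A z0 + of_real (1 - t) * q"
  proof -
    define k where "k = complex_of_real (1 + m)"
    have "k * v w * B = v w * A z0 + (k - 1)"
      using eq unfolding k_def[symmetric] by (simp add: algebra_simps)
    then have "B = (v w * A z0 + (k - 1)) / (k * v w)"
      using vw m1 unfolding k_def[symmetric] by (simp add: eq_divide_eq mult_ac)
    also have "\<dots> = 1 / k * A z0 + (1 - 1 / k) * (1 / v w)"
      using vw m1 unfolding k_def[symmetric] by (simp add: field_simps)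
    also have "1 / k = of_real t" by (simp add: k_def t_def)
    finally show ?thesis by (simp add: q_def)
  qed
  moreover have "norm (of_real t * A z0 + of_real (1 - t) * q - 1)
      < norm w * norm (of_real t * A z0 + of_real (1 - t) * q - (- cis (2 * l)))"
  proof (rule norm_ratio_strictly_convex[OF _ _ _ _ t])
    show "norm w < 1" using w r by simp
    show "norm (q - 1) \<le> norm w * norm (q - (- cis (2 * l)))"
      using vbound[OF w] by (simp add: q_def)
    have "A z0 + cis (2 * l) \<noteq> 0"
    proof
      assume a: "A z0 + cis (2 * l) = 0"
      then have "A z0 = 1" using Abound[OF nz0(2)] by simp
      then show False using a one_plus_cis_double_nonzero[OF l] by simp
    qed
    moreover have "norm z0 * 1 < norm z0 * norm (k z0)"
      by (rule mult_strict_left_mono) (use k1 s nz0(1) in auto)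
    then have "norm z0 < norm w" by (simp add: w_def phik[of z0] norm_mult)
    ultimately have "norm z0 * norm (A z0 + cis (2 * l)) < norm w * norm (A z0 + cis (2 * l))" by simp
    then show "norm (A z0 - 1) < norm w * norm (A z0 - (- cis (2 * l)))"
      using Abound[OF nz0(2)] by simp
  qed auto
  ultimately have "norm (B - 1) < norm w * norm (B + cis (2 * l))" by simp
  moreover have "w \<noteq> 1" using w r by auto
  ultimately show False
    using P_fun_ratio(1)[of w l] by (metis B_def less_irrefl norm_mult)
qed

section \<open>Lifting through a locally injective function\<close>

text \<open>The constants are uniform over a compact set: \<open>e\<close> is a Lebesgue number for the cover by open sets
  of injectivity, and \<open>h\<close> is the minimum of \<open>|v x - v w|\<close> over \<open>|x - w| = e / 2\<close>, which is positive by
  injectivity.  The images are taken of balls of half the radius so that a solution stays in the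
  ball of injectivity when its centre moves a little.\<close>

lemma uniform_local_inverse:
  fixes v :: "complex \<Rightarrow> complex"
  assumes v: "v holomorphic_on S" "open S" and K: "compact K" "K \<subseteq> S"
    and d: "\<And>w. w \<in> K \<Longrightarrow> deriv v w \<noteq> 0"
  obtains e h where "0 < e" "0 < h"
    "\<And>w. w \<in> K \<Longrightarrow> ball w e \<subseteq> S" "\<And>w. w \<in> K \<Longrightarrow> inj_on v (ball w e)"
    "\<And>w. w \<in> K \<Longrightarrow> ball (v w) h \<subseteq> v ` ball w (e / 2)"
proof (cases "K = {}")
  case True
  then show thesis using that[of 1 1] by auto
next
  case False
  obtain e where e: "0 < e" "\<And>w. w \<in> K \<Longrightarrow> \<exists>G\<in>{G. open G \<and> G \<subseteq> S \<and> inj_on v G}. ball w e \<subseteq> G"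
  proof (rule Heine_Borel_lemma[OF K(1)])
    show "K \<subseteq> \<Union>{G. open G \<and> G \<subseteq> S \<and> inj_on v G}"
    proof
      fix w assume w: "w \<in> K"
      obtain \<delta> where "\<delta> > 0" "ball w \<delta> \<subseteq> S" "inj_on v (ball w \<delta>)"
        using has_complex_derivative_locally_injective[OF v(1) _ v(2) d[OF w]] w K(2) by blast
      then show "w \<in> \<Union>{G. open G \<and> G \<subseteq> S \<and> inj_on v G}"
        by (intro UnionI[of "ball w \<delta>"]) auto
    qed
  qed auto
  have eS: "ball w e \<subseteq> S" and inj: "inj_on v (ball w e)" if "w \<in> K" for w
    using e(2)[OF that] inj_on_subset by blast+
  let ?C = "K \<times> sphere (0::complex) (e/2)"
  have cont: "continuous_on ?C (\<lambda>x. norm (v (fst x + snd x) - v (fst x)))"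
  proof (intro continuous_intros)
    have cv: "continuous_on S v" using v(1) holomorphic_on_imp_continuous_on by blast
    show "continuous_on ?C (\<lambda>x. v (fst x + snd x))"
    proof (rule continuous_on_compose2[OF cv])
      show "(\<lambda>x. fst x + snd x) ` ?C \<subseteq> S"
      proof (rule image_subsetI)
        fix x assume x: "x \<in> ?C"
        then have "fst x \<in> K" "norm (snd x) = e/2" by (auto simp: mem_Times_iff)
        then have "fst x + snd x \<in> ball (fst x) e" using e(1) by (simp add: dist_norm)
        then show "fst x + snd x \<in> S" using eS \<open>fst x \<in> K\<close> by blast
      qed
    qed (intro continuous_intros)
    show "continuous_on ?C (\<lambda>x. v (fst x))"
      by (rule continuous_on_compose2[OF cv]) (use K(2) in \<open>auto intro!: continuous_intros\<close>)
  qed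
  have "compact ?C" using K(1) by (intro compact_Times) auto
  moreover have "?C \<noteq> {}" using False e(1) by simp
  ultimately obtain x where x: "x \<in> ?C"
    "\<And>y. y \<in> ?C \<Longrightarrow> norm (v (fst x + snd x) - v (fst x)) \<le> norm (v (fst y + snd y) - v (fst y))"
    using continuous_attains_inf[OF _ _ cont] by blast
  define h where "h = norm (v (fst x + snd x) - v (fst x))"
  have fx: "fst x \<in> K" "norm (snd x) = e/2" using x(1) by (auto simp: mem_Times_iff)
  have "v (fst x + snd x) \<noteq> v (fst x)"
  proof
    assume "v (fst x + snd x) = v (fst x)"
    then have "fst x + snd x = fst x"
      by (rule inj_onD[OF inj[OF fx(1)]]) (use fx e(1) in \<open>auto simp: dist_norm\<close>)
    then show False using fx e(1) by auto
  qed
  then have h: "h > 0" by (simp add: h_def)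
  show thesis
  proof (rule that[OF e(1) h eS inj])
    fix w assume w: "w \<in> K"
    have cs: "cball w (e/2) \<subseteq> S" using eS[OF w] e(1) by (auto simp: subset_iff)
    show "ball (v w) h \<subseteq> v ` ball w (e/2)"
    proof (rule ball_subset_open_map_image)
      show "continuous_on (closure (ball w (e/2))) v"
        using e(1) cs v(1) by (simp add: holomorphic_on_imp_continuous_on holomorphic_on_subset)
      have "ball w (e/2) \<subseteq> ball w e" using e(1) by auto
      then have "open (v ` ball w (e/2))"
        by (intro open_mapping_thm3)
          (use holomorphic_on_subset[OF v(1)] cs inj[OF w] inj_on_subset in \<open>force+\<close>)
      then show "open (v ` interior (ball w (e/2)))" by simp
      fix z assume "z \<in> frontier (ball w (e/2))"
      then have "norm (z - w) = e/2" using e(1) by (simp add: frontier_ball dist_norm norm_minus_commute)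
      then show "h \<le> norm (v z - v w)" using x(2)[of "(w, z - w)"] w by (simp add: h_def)
    qed (use e(1) h in auto)
  qed
qed

text \<open>An approximate lift \<open>c\<close> of \<open>u\<close> through \<open>v\<close> determines an exact one: \<open>\<phi> z\<close> is the solution of
  \<open>v x = u z\<close> next to \<open>c z\<close>.  Near any point \<open>z0\<close> all these solutions stay in the one ball around \<open>c z0\<close>
  on which \<open>v\<close> is injective, so there \<open>\<phi>\<close> is a fixed branch of the inverse of \<open>v\<close> composed with \<open>u\<close>;
  no gluing of local branches is needed.\<close>

lemma lift_near_approximation:
  fixes u v c :: "complex \<Rightarrow> complex"
  assumes v: "v holomorphic_on S" and U: "open U"
    and u: "u holomorphic_on U" and c: "continuous_on U c" "\<And>z. z \<in> U \<Longrightarrow> c z \<in> K"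
    and e: "0 < e" "\<And>w. w \<in> K \<Longrightarrow> ball w e \<subseteq> S" "\<And>w. w \<in> K \<Longrightarrow> inj_on v (ball w e)"
    and h: "\<And>w. w \<in> K \<Longrightarrow> ball (v w) h \<subseteq> v ` ball w (e / 2)"
    and near: "\<And>z. z \<in> U \<Longrightarrow> dist (v (c z)) (u z) < h"
  obtains \<phi> where "\<phi> holomorphic_on U" "\<And>z. z \<in> U \<Longrightarrow> \<phi> z \<in> ball (c z) (e / 2)"
    "\<And>z. z \<in> U \<Longrightarrow> v (\<phi> z) = u z"
proof -
  have "\<exists>w. w \<in> ball (c z) (e/2) \<and> v w = u z" if "z \<in> U" for z
    using h[OF c(2)[OF that]] near[OF that] by (force simp: image_iff subset_iff)
  then obtain \<phi> where phi: "\<And>z. z \<in> U \<Longrightarrow> \<phi> z \<in> ball (c z) (e/2)" "\<And>z. z \<in> U \<Longrightarrow> v (\<phi> z) = u z"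
    by metis
  have "\<phi> field_differentiable (at z0)" if z0: "z0 \<in> U" for z0
  proof -
    let ?B = "ball (c z0) e"
    have K0: "c z0 \<in> K" using c(2)[OF z0] .
    have vB: "v holomorphic_on ?B" using v e(2)[OF K0] holomorphic_on_subset by blast
    obtain g where g: "g holomorphic_on v ` ?B" "\<And>w. w \<in> ?B \<Longrightarrow> g (v w) = w"
      using holomorphic_has_inverse[OF vB open_ball e(3)[OF K0]] by metis
    have oB: "open (v ` ?B)" by (rule open_mapping_thm3[OF vB open_ball e(3)[OF K0]])
    let ?N = "U \<inter> c -` ball (c z0) (e/2)"
    have N: "open ?N" by (rule continuous_open_preimage[OF c(1) U open_ball])
    have z0N: "z0 \<in> ?N" using z0 e(1) by simp
    have inB: "\<phi> z \<in> ?B" if "z \<in> ?N" for z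
      using phi(1)[of z] that dist_triangle[of "c z0" "\<phi> z" "c z"] by auto
    have "(\<lambda>z. g (u z)) holomorphic_on ?N"
    proof (rule holomorphic_on_compose_gen[unfolded o_def, OF _ g(1)])
      show "u holomorphic_on ?N" using u by (rule holomorphic_on_subset) auto
      show "u ` ?N \<subseteq> v ` ?B" using inB phi(2) by (force simp: image_iff)
    qed
    then have gu: "((\<lambda>z. g (u z)) has_field_derivative deriv (\<lambda>z. g (u z)) z0) (at z0)"
      using N z0N by (rule holomorphic_derivI)
    have "g (u z) = \<phi> z" if "z \<in> ?N" for z
      using g(2)[OF inB[OF that]] phi(2)[of z] that by simp
    then show ?thesis
      using has_field_derivative_transform_within_open[OF gu N z0N] field_differentiable_def by blast
  qed
  then have "\<phi> holomorphic_on U" using U by (simp add: holomorphic_on_def field_differentiable_at_within)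
  then show thesis using that phi by blast
qed

text \<open>As \<open>v\<close> is only locally injective, \<open>u = v \<circ> \<phi>\<close> has to be solved by continuation.  A lift on the
  disc of radius \<open>\<rho>\<close> gives the approximate lift \<open>\<phi> (z / s)\<close> on the disc of radius \<open>s \<rho>\<close>, where the
  factor \<open>s > 1\<close> is fixed by the uniform continuity of \<open>u\<close>.  The bound \<open>|\<phi> z| \<le> |z|\<close> of the previous section is
  what keeps the lift in the compact set on which \<open>s\<close> was chosen, so the step can be repeated
  until the radius \<open>R\<close> is reached.\<close>

lemma riccati_subordination:
  fixes u v A :: "complex \<Rightarrow> complex"
  assumes l: "cos l > 0" and r: "r \<le> 1" and R: "0 < R" "R < r"
    and v: "v holomorphic_on ball 0 r"
    and vnz: "\<And>w. w \<in> ball 0 r \<Longrightarrow> v w \<noteq> 0"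
    and vbound: "\<And>w. w \<in> ball 0 r \<Longrightarrow> norm (1 / v w - 1) \<le> norm w * norm (1 / v w + cis (2 * l))"
    and vode: "\<And>w. w \<in> ball 0 r \<Longrightarrow> w * deriv v w = 1 - v w * P_fun l w"
    and dv: "\<And>w. w \<in> ball 0 r \<Longrightarrow> deriv v w \<noteq> 0"
    and u: "u holomorphic_on ball 0 r"
    and uode: "\<And>z. z \<in> ball 0 r \<Longrightarrow> z * deriv u z = 1 - u z * A z"
    and Abound: "\<And>z. z \<in> ball 0 r \<Longrightarrow> norm (A z - 1) \<le> norm z * norm (A z + cis (2 * l))"
    and init: "v 0 = u 0"
  obtains \<phi> where "\<phi> holomorphic_on ball 0 R"
    "\<And>z. z \<in> ball 0 R \<Longrightarrow> norm (\<phi> z) \<le> norm z" "\<And>z. z \<in> ball 0 R \<Longrightarrow> v (\<phi> z) = u z"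
proof -
  let ?K = "cball (0::complex) R"
  have KS: "?K \<subseteq> ball 0 r" using R by auto
  obtain e h where e: "0 < e" and h0: "0 < h"
    and es: "\<And>w. w \<in> ?K \<Longrightarrow> ball w e \<subseteq> ball 0 r"
    and ei: "\<And>w. w \<in> ?K \<Longrightarrow> inj_on v (ball w e)"
    and eh: "\<And>w. w \<in> ?K \<Longrightarrow> ball (v w) h \<subseteq> v ` ball w (e / 2)"
    using uniform_local_inverse[OF v open_ball compact_cball KS] dv KS by blast
  have "uniformly_continuous_on ?K u"
    using holomorphic_on_imp_continuous_on[OF holomorphic_on_subset[OF u KS]]
    by (rule compact_uniformly_continuous) simp
  then obtain \<delta> where delta: "0 < \<delta>" "\<And>x y. x \<in> ?K \<Longrightarrow> y \<in> ?K \<Longrightarrow> dist x y < \<delta> \<Longrightarrow> dist (u x) (u y) < h"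
    unfolding uniformly_continuous_on_def using h0 by metis
  define liftable where "liftable = (\<lambda>\<rho>. \<exists>\<phi>. \<phi> holomorphic_on ball 0 \<rho> \<and> \<phi> 0 = 0 \<and>
    (\<forall>z\<in>ball 0 \<rho>. norm (\<phi> z) \<le> norm z \<and> v (\<phi> z) = u z))"
  have extend: "liftable \<rho>" if rho: "0 < \<rho>" "\<rho> \<le> R" and c: "continuous_on (ball 0 \<rho>) c" "c 0 = 0"
    "\<And>z. z \<in> ball 0 \<rho> \<Longrightarrow> c z \<in> ?K" "\<And>z. z \<in> ball 0 \<rho> \<Longrightarrow> dist (v (c z)) (u z) < h" for \<rho> c
  proof -
    have sub: "ball 0 \<rho> \<subseteq> ball (0::complex) r" using rho R by auto
    note u' = holomorphic_on_subset[OF u sub]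
    obtain \<phi> where phi: "\<phi> holomorphic_on ball 0 \<rho>" "\<And>z. z \<in> ball 0 \<rho> \<Longrightarrow> \<phi> z \<in> ball (c z) (e / 2)"
      "\<And>z. z \<in> ball 0 \<rho> \<Longrightarrow> v (\<phi> z) = u z"
      using lift_near_approximation[OF v open_ball u' c(1,3) e es ei eh c(4)] by blast
    have "\<phi> 0 = 0"
    proof (rule inj_onD[OF ei[of 0]])
      show "v (\<phi> 0) = v 0" using phi(3)[of 0] rho init by simp
      show "\<phi> 0 \<in> ball 0 e" using phi(2)[of 0] rho c(2) e by simp
    qed (use e R in auto)
    moreover have "norm (\<phi> z) \<le> norm z" if z: "z \<in> ball 0 \<rho>" for z
    proof (rule subordination_modulus_bound[OF l r v vnz vbound vode u'])
      show "\<phi> x \<in> ball 0 r" if "x \<in> ball 0 \<rho>" for x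
        using es[OF c(3)[OF that]] phi(2)[OF that] e by (force simp: subset_iff)
    qed (use \<open>\<phi> 0 = 0\<close> phi z sub uode Abound in auto)
    ultimately show ?thesis using phi unfolding liftable_def by blast
  qed
  \<comment> \<open>This factor makes \<open>|z - z / s| < \<delta>\<close> for all \<open>|z| < s R\<close>.\<close>
  define s where "s = 1 + \<delta> / R"
  have s1: "s > 1" using delta(1) R by (simp add: s_def)
  \<comment> \<open>Near the origin the constant \<open>0\<close> is already an approximate lift, as \<open>v 0 = u 0\<close>.\<close>
  have base: "liftable (min R \<delta>)"
  proof (rule extend[of _ "\<lambda>_. 0"])
    show "dist (v 0) (u z) < h" if "z \<in> ball 0 (min R \<delta>)" for z
      unfolding init by (rule delta(2)) (use that R in auto)
  qed (use delta R in auto)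
  have step: "liftable (min R (s * \<rho>))" if rho: "0 < \<rho>" "\<rho> \<le> R" and liftable: "liftable \<rho>" for \<rho>
  proof -
    obtain \<phi> where phi: "\<phi> holomorphic_on ball 0 \<rho>" "\<phi> 0 = 0"
      "\<And>z. z \<in> ball 0 \<rho> \<Longrightarrow> norm (\<phi> z) \<le> norm z" "\<And>z. z \<in> ball 0 \<rho> \<Longrightarrow> v (\<phi> z) = u z"
      using liftable unfolding liftable_def by blast
    have scale: "z / of_real s \<in> ball 0 \<rho>" if "z \<in> ball 0 (min R (s * \<rho>))" for z :: complex
      using that s1 by (simp add: norm_divide field_simps)
    show ?thesis
    proof (rule extend[of _ "\<lambda>z. \<phi> (z / of_real s)"])
      show "continuous_on (ball 0 (min R (s * \<rho>))) (\<lambda>z. \<phi> (z / of_real s))"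
        by (rule continuous_on_compose2[OF holomorphic_on_imp_continuous_on[OF phi(1)]])
          (use s1 scale in \<open>auto intro!: continuous_intros\<close>)
      fix z :: complex assume z: "z \<in> ball 0 (min R (s * \<rho>))"
      have zs: "norm (z / of_real s) < R" using scale[OF z] rho by simp
      show "\<phi> (z / of_real s) \<in> ?K" using phi(3)[OF scale[OF z]] zs by simp
      have "z - z / of_real s = of_real (s - 1) * (z / of_real s)" using s1 by (simp add: field_simps)
      then have "norm (z - z / of_real s) = (s - 1) * norm (z / of_real s)"
        using s1 by (metis abs_of_pos diff_gt_0_iff_gt norm_mult norm_of_real)
      also have "\<dots> < (s - 1) * R" using zs s1 by (intro mult_strict_left_mono) auto
      also have "\<dots> = \<delta>" using R by (simp add: s_def)
      finally have "dist (z / of_real s) z < \<delta>" by (simp add: dist_norm norm_minus_commute)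
      then show "dist (v (\<phi> (z / of_real s))) (u z) < h"
        unfolding phi(4)[OF scale[OF z]] by (intro delta(2)) (use zs z in auto)
    qed (use rho R s1 phi(2) in auto)
  qed
  define \<rho>0 where "\<rho>0 = min R \<delta>"
  have rho0: "0 < \<rho>0" "\<rho>0 \<le> R" using R delta by (auto simp: \<rho>0_def)
  have "liftable (min R (s ^ n * \<rho>0))" for n
  proof (induction n)
    case 0
    then show ?case using base by (simp add: \<rho>0_def)
  next
    case (Suc n)
    have "min R (s * min R (s ^ n * \<rho>0)) = min R (s ^ Suc n * \<rho>0)"
    proof (cases "R \<le> s ^ n * \<rho>0")
      case True
      have "R \<le> s * R" using s1 R by simp
      moreover have "s * R \<le> s * (s ^ n * \<rho>0)" using True s1 by simp
      ultimately show ?thesis using True by (simp add: mult.assoc)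
    qed (simp add: mult.assoc)
    moreover have "0 < min R (s ^ n * \<rho>0)" using R rho0 s1 by simp
    ultimately show ?case using step[OF _ _ Suc.IH] by simp
  qed
  moreover obtain n where "R / \<rho>0 < s ^ n" using real_arch_pow[OF s1] by blast
  then have "min R (s ^ n * \<rho>0) = R" using rho0 by (simp add: field_simps)
  ultimately have "liftable R" by metis
  then show thesis using that unfolding liftable_def by blast
qed

section \<open>Reciprocal logarithmic derivatives\<close>

text \<open>Both \<open>f / (z f')\<close> and the reciprocal of \<open>Q_fun l\<close> have the form \<open>N z / z\<close> with \<open>N\<close> holomorphic and
  \<open>N z = z + \<dots>\<close>; the Riccati equations below are read off from this identity.\<close>

lemma quotient_by_identity:
  assumes N: "N holomorphic_on ball 0 1" "N 0 = 0" "deriv N 0 = 1"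
  defines "u \<equiv> \<lambda>z. if z = 0 then 1 else N z / z"
  shows "u holomorphic_on ball 0 1"
    and "\<And>z. z \<in> ball 0 1 \<Longrightarrow> z * deriv u z = deriv N z - u z"
proof -
  have "(\<lambda>z. if z = 0 then deriv N 0 else (N z - N 0) / (z - 0)) holomorphic_on ball 0 1"
    by (rule pole_lemma[OF N(1)]) auto
  then show u: "u holomorphic_on ball 0 1" unfolding u_def N(2,3) diff_0_right .
  have Nu: "N = (\<lambda>z. z * u z)" by (auto simp: u_def N(2))
  fix z :: complex assume "z \<in> ball 0 1"
  then have "(u has_field_derivative deriv u z) (at z)" using u by (simp add: holomorphic_derivI)
  then have "(N has_field_derivative u z + z * deriv u z) (at z)"
    unfolding Nu by (auto intro!: derivative_eq_intros)
  then show "z * deriv u z = deriv N z - u z" by (simp add: DERIV_imp_deriv)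
qed

text \<open>At a zero \<open>a\<close> of order \<open>n\<close> of \<open>f'\<close>, the function \<open>z f''/f'\<close> has a simple pole with residue \<open>n a\<close>.
  Holomorphy of \<open>convexity_fun f\<close> excludes this: multiplying by \<open>w - a\<close> and letting \<open>w\<close> tend to \<open>a\<close>
  would give \<open>0 = n a\<close>, while \<open>a \<noteq> 0\<close> because \<open>f'(0) = 1\<close>.\<close>

lemma Robertson_deriv_nonzero:
  assumes f: "f \<in> Robertson l" and a: "a \<in> ball 0 1"
  shows "deriv f a \<noteq> 0"
proof
  assume a0: "deriv f a = 0"
  have fh: "f holomorphic_on ball 0 1" and f1: "deriv f 0 = 1"
    and Ch: "convexity_fun f holomorphic_on ball 0 1" using f by (auto simp: Robertson_def)
  have dfh: "deriv f holomorphic_on ball 0 1" using fh by (simp add: holomorphic_deriv)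
  have az: "a \<noteq> 0" using a0 f1 by auto
  have nc: "\<not> deriv f constant_on ball 0 1"
  proof
    assume "deriv f constant_on ball 0 1"
    then have "deriv f a = deriv f 0" using a by (metis centre_in_ball constant_on_def zero_less_one)
    then show False using a0 f1 by simp
  qed
  obtain g r n where g: "0 < n" "0 < r" "ball a r \<subseteq> ball 0 1" "g holomorphic_on ball a r"
    "\<And>w. w \<in> ball a r \<Longrightarrow> deriv f w = (w - a) ^ n * g w" "\<And>w. w \<in> ball a r \<Longrightarrow> g w \<noteq> 0"
    using holomorphic_factor_zero_nonconstant[OF dfh open_ball connected_ball a a0 nc] by metis
  define F where "F = (\<lambda>w. (convexity_fun f w - 1) * (w - a))"
  define G where "G = (\<lambda>w. w * (of_nat n + (w - a) * deriv g w / g w))"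
  have FG: "F w = G w" if w: "w \<in> ball a r" "w \<noteq> a" for w
  proof -
    have "(g has_field_derivative deriv g w) (at w)" using g w by (simp add: holomorphic_derivI)
    then have "((\<lambda>w. (w - a) ^ n * g w) has_field_derivative
        of_nat n * (w - a) ^ (n - 1) * g w + (w - a) ^ n * deriv g w) (at w)"
      by (auto intro!: derivative_eq_intros)
    then have "(deriv f has_field_derivative
        of_nat n * (w - a) ^ (n - 1) * g w + (w - a) ^ n * deriv g w) (at w)"
      by (rule has_field_derivative_transform_within_open[of _ _ _ "ball a r"]) (use g w in auto)
    then have d2: "deriv (deriv f) w = of_nat n * (w - a) ^ (n - 1) * g w + (w - a) ^ n * deriv g w"
      by (rule DERIV_imp_deriv)
    have pw: "(w - a) ^ n = (w - a) ^ (n - 1) * (w - a)" using g(1) by (simp add: power_eq_if)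
    have alg: "(of_nat n * E * g w + E * D * deriv g w) * D
        = E * D * g w * (of_nat n + D * deriv g w / g w)" for E D
      using g(6)[OF w(1)] by (simp add: field_simps)
    have "deriv (deriv f) w * (w - a) = deriv f w * (of_nat n + (w - a) * deriv g w / g w)"
      unfolding d2 g(5)[OF w(1)] pw by (rule alg)
    moreover have "deriv f w \<noteq> 0" using g(5,6)[OF w(1)] w by simp
    ultimately show ?thesis by (simp add: F_def G_def convexity_fun_def field_simps)
  qed
  have "continuous_on (ball a r) F" unfolding F_def
    by (intro continuous_intros holomorphic_on_imp_continuous_on holomorphic_on_subset[OF Ch g(3)])
  moreover have "continuous_on (ball a r) G" unfolding G_def
    by (intro continuous_intros holomorphic_on_imp_continuous_on holomorphic_deriv g) (use g(6) in auto)
  ultimately have "F \<midarrow>a\<rightarrow> F a" "G \<midarrow>a\<rightarrow> G a"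
    using g(2) by (auto simp: continuous_on_eq_continuous_at isCont_def)
  moreover have "eventually (\<lambda>w. F w = G w) (at a)"
    unfolding eventually_at_topological using FG g(2) by (intro exI[of _ "ball a r"]) auto
  ultimately have "F a = G a" by (metis LIM_unique tendsto_cong)
  then show False using az g(1) by (simp add: F_def G_def)
qed

text \<open>The equation \<open>z p' = p (P - p)\<close> for \<open>p = z f'/f\<close> becomes linear for \<open>u = 1 / p\<close>.  This \<open>u\<close> is
  holomorphic even where \<open>p\<close> might have a pole, that is, at zeros of \<open>f\<close> other than the origin.\<close>

lemma Robertson_riccati:
  assumes f: "f \<in> Robertson l"
  obtains u where "u holomorphic_on ball 0 1" "u 0 = 1"
    "\<And>z. z \<in> ball 0 1 \<Longrightarrow> z * deriv u z = 1 - u z * convexity_fun f z"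
    "\<And>z. starlike_fun f z = 1 / u z"
proof -
  have fh: "f holomorphic_on ball 0 1" and f0: "f 0 = 0" and f1: "deriv f 0 = 1"
    using f by (auto simp: Robertson_def)
  note nz = Robertson_deriv_nonzero[OF f]
  define N where "N = (\<lambda>z. f z / deriv f z)"
  have Nh: "N holomorphic_on ball 0 1"
    unfolding N_def by (intro holomorphic_intros holomorphic_deriv fh) (use nz in auto)
  have Nd: "deriv N z = 1 - N z * deriv (deriv f) z / deriv f z" if z: "z \<in> ball 0 1" for z
  proof (rule DERIV_imp_deriv)
    have "(f has_field_derivative deriv f z) (at z)" using fh z by (simp add: holomorphic_derivI)
    moreover have "(deriv f has_field_derivative deriv (deriv f) z) (at z)"
      using holomorphic_deriv[OF fh open_ball] z by (simp add: holomorphic_derivI)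
    ultimately show "(N has_field_derivative 1 - N z * deriv (deriv f) z / deriv f z) (at z)"
      unfolding N_def using nz[OF z] by (auto intro!: derivative_eq_intros simp: field_simps)
  qed
  have N0: "N 0 = 0" by (simp add: N_def f0)
  have "deriv N 0 = 1" using Nd[of 0] N0 by simp
  note q = quotient_by_identity[OF Nh N0 this]
  define u where "u = (\<lambda>z. if z = 0 then 1 else N z / z)"
  note q = q[folded u_def]
  show thesis
  proof (rule that)
    show "u holomorphic_on ball 0 1" by (rule q(1))
    show "u 0 = 1" by (simp add: u_def)
    show "z * deriv u z = 1 - u z * convexity_fun f z" if z: "z \<in> ball 0 1" for z
    proof (cases "z = 0")
      case True
      then show ?thesis by (simp add: u_def convexity_fun_def)
    next
      case False
      have "z * deriv u z = deriv N z - N z / z" using q(2)[OF z] False by (simp add: u_def)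
      then show ?thesis using False unfolding Nd[OF z] by (simp add: u_def convexity_fun_def field_simps)
    qed
    show "starlike_fun f z = 1 / u z" for z by (simp add: starlike_fun_def u_def N_def)
  qed
qed

text \<open>The half-plane condition says that the ratio of distances to \<open>1\<close> and to its mirror image is
  below \<open>1\<close>; the quotient of the underlying differences vanishes at \<open>0\<close>, so the Schwarz lemma applies.\<close>

lemma Robertson_disc_bound:
  assumes f: "f \<in> Robertson l" and l: "cos l > 0" and z: "z \<in> ball 0 1"
  shows "norm (convexity_fun f z - 1) \<le> norm z * norm (convexity_fun f z + cis (2 * l))"
proof -
  have Ch: "convexity_fun f holomorphic_on ball 0 1" using f by (simp add: Robertson_def)
  have lt: "norm (convexity_fun f x - 1) < norm (convexity_fun f x + cis (2 * l))" if "x \<in> ball 0 1" for x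
    using f that half_plane_iff[OF l] by (simp add: Robertson_def)
  have nz: "convexity_fun f x + cis (2 * l) \<noteq> 0" if "x \<in> ball 0 1" for x
    using lt[OF that] by auto
  define \<omega> where "\<omega> = (\<lambda>x. (convexity_fun f x - 1) / (convexity_fun f x + cis (2 * l)))"
  have "norm (\<omega> z) \<le> norm z"
  proof (rule Schwarz_Lemma(1))
    show "\<omega> holomorphic_on ball 0 1"
      unfolding \<omega>_def by (intro holomorphic_intros Ch) (use nz in auto)
    show "\<omega> 0 = 0" by (simp add: \<omega>_def convexity_fun_def)
    show "norm (\<omega> x) < 1" if "norm x < 1" for x
      using lt[of x] nz[of x] that by (simp add: \<omega>_def norm_divide)
  qed (use z in auto)
  then show ?thesis using nz[OF z] by (simp add: \<omega>_def norm_divide field_simps)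
qed

section \<open>The extremal function\<close>

text \<open>The function \<open>f / (z f')\<close> for the extremal \<open>f z = ((1 - z) powr (- \<mu>) - 1) / \<mu>\<close>,
  \<open>\<mu> = cis (2 l)\<close>, whose \<open>convexity_fun\<close> is \<open>P_fun l\<close>.  Unlike \<open>Q_fun l\<close> it has no poles in the unit disc.\<close>

definition Q_recip :: "real \<Rightarrow> complex \<Rightarrow> complex" where
  "Q_recip l z =
     (if z = 0 then 1 else (1 - z - (1 - z) powr (1 + cis (2 * l))) / cis (2 * l) / z)"

lemma Q_fun_eq: "Q_fun l z = 1 / Q_recip l z"
  by (simp add: Q_fun_def Q_recip_def)

lemma Q_recip_0: "Q_recip l 0 = 1"
  by (simp add: Q_recip_def)

lemma Q_recip_riccati:
  shows "Q_recip l holomorphic_on ball 0 1"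
    and "\<And>z. z \<in> ball 0 1 \<Longrightarrow> z * deriv (Q_recip l) z = 1 - Q_recip l z * P_fun l z"
proof -
  define \<mu> where "\<mu> = cis (2 * l)"
  have mu: "\<mu> \<noteq> 0" by (simp add: \<mu>_def)
  define N where "N = (\<lambda>z. (1 - z - (1 - z) powr (1 + \<mu>)) / \<mu>)"
  have slit: "1 - z \<notin> \<real>\<^sub>\<le>\<^sub>0" if "z \<in> ball 0 1" for z :: complex
  proof -
    have "Re z < 1" using that complex_Re_le_cmod[of z] by simp
    then show ?thesis by (auto simp: complex_nonpos_Reals_iff)
  qed
  have Nd: "(N has_field_derivative (- 1 + (1 + \<mu>) * (1 - z) powr \<mu>) / \<mu>) (at z)"
    if "z \<in> ball 0 1" for z
    unfolding N_def using slit[OF that] mu by (auto intro!: derivative_eq_intros)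
  then have Nh: "N holomorphic_on ball 0 1" unfolding holomorphic_on_open[OF open_ball] by blast
  have N0: "N 0 = 0" by (simp add: N_def)
  have "deriv N 0 = 1" using DERIV_imp_deriv[OF Nd[of 0]] mu by simp
  note q = quotient_by_identity[OF Nh N0 this]
  have v: "Q_recip l = (\<lambda>z. if z = 0 then 1 else N z / z)"
    unfolding Q_recip_def N_def \<mu>_def ..
  show "Q_recip l holomorphic_on ball 0 1" using q(1) v by simp
  fix z :: complex assume z: "z \<in> ball 0 1"
  show "z * deriv (Q_recip l) z = 1 - Q_recip l z * P_fun l z"
  proof (cases "z = 0")
    case True
    then show ?thesis by (simp add: Q_recip_def P_fun_def)
  next
    case False
    define W where "W = (1 - z) powr \<mu>"
    have z1: "1 - z \<noteq> 0" using z by auto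
    have "(1 - z) powr (1 + \<mu>) = (1 - z) * W"
      using z1 by (simp add: powr_add W_def)
    then have Nz: "N z = (1 - z) * (1 - W) / \<mu>" by (simp add: N_def algebra_simps)
    have "z * deriv (Q_recip l) z = deriv N z - Q_recip l z" using q(2)[OF z] v by simp
    also have "\<dots> = (- 1 + (1 + \<mu>) * W) / \<mu> - N z / z"
      using DERIV_imp_deriv[OF Nd[OF z]] False v by (simp add: W_def)
    also have "\<dots> = 1 - N z / z * P_fun l z"
      unfolding P_fun_def \<mu>_def[symmetric] Nz using mu z1 False by (simp add: divide_simps) (simp add: algebra_simps)
    finally show ?thesis using False v by simp
  qed
qed

text \<open>Differentiating the Riccati equation at \<open>0\<close> gives \<open>2 v'(0) = - P'(0)\<close>, where \<open>v = Q_recip l\<close> and \<open>P = P_fun l\<close>.\<close>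

lemma deriv_Q_recip_0: "deriv (Q_recip l) 0 = - (1 + cis (2 * l)) / 2"
proof -
  let ?v = "Q_recip l"
  note vh = Q_recip_riccati(1)[of l]
  have v1: "(?v has_field_derivative deriv ?v 0) (at 0)" using vh by (simp add: holomorphic_derivI)
  have v2: "(deriv ?v has_field_derivative deriv (deriv ?v) 0) (at 0)"
    using holomorphic_deriv[OF vh open_ball] by (simp add: holomorphic_derivI)
  have P: "(P_fun l has_field_derivative 1 + cis (2 * l)) (at 0)"
    unfolding P_fun_def[abs_def] by (auto intro!: derivative_eq_intros)
  have "((\<lambda>z. 1 - ?v z * P_fun l z) has_field_derivative - deriv ?v 0 - (1 + cis (2 * l))) (at 0)"
    by (rule derivative_eq_intros v1 P refl)+ (simp add: Q_recip_0 P_fun_def)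
  then have "((\<lambda>z. z * deriv ?v z) has_field_derivative - deriv ?v 0 - (1 + cis (2 * l))) (at 0)"
    by (rule has_field_derivative_transform_within_open[of _ _ _ "ball 0 1"])
      (use Q_recip_riccati(2) in auto)
  moreover have "((\<lambda>z. z * deriv ?v z) has_field_derivative deriv ?v 0) (at 0)"
    using v2 by (auto intro!: derivative_eq_intros)
  ultimately have h: "deriv ?v 0 = - deriv ?v 0 - (1 + cis (2 * l))" by (rule DERIV_unique[rotated])
  have "deriv ?v 0 + deriv ?v 0 = deriv ?v 0 + (- deriv ?v 0 - (1 + cis (2 * l)))"
    by (rule arg_cong[OF h])
  then have e: "deriv ?v 0 + deriv ?v 0 = - (1 + cis (2 * l))" by simp
  have "deriv ?v 0 = (deriv ?v 0 + deriv ?v 0) / 2" by simp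
  then show ?thesis unfolding e .
qed

section \<open>Admissible radii\<close>

definition admissible_radii :: "real \<Rightarrow> real set" where
  "admissible_radii l = {r. 0 < r \<and> r < 1 \<and>
     (\<lambda>z. Q_fun l (of_real r * z)) \<prec>\<^sub>D (\<lambda>z. P_fun l (of_real r * z))}"

text \<open>The inner function of the subordination turns, by the Schwarz lemma, into a bound at each
  point of the disc.  By the Riccati equation a critical point \<open>w \<noteq> 0\<close> of \<open>v = Q_recip l\<close> would satisfy
  \<open>Q_fun l w = P_fun l w\<close>, the case of equality in that bound.  The inner function would then be
  the identity, so \<open>Q_fun l = P_fun l\<close> throughout and \<open>v' = 0\<close>, although \<open>v'(0) \<noteq> 0\<close>.\<close>

lemma admissible_radius_bounds:
  assumes l: "cos l > 0" and r: "r \<in> admissible_radii l" and w: "w \<in> ball 0 r"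
  shows "norm (1 / Q_recip l w - 1) \<le> norm w * norm (1 / Q_recip l w + cis (2 * l))"
    and "Q_recip l w \<noteq> 0" and "deriv (Q_recip l) w \<noteq> 0"
proof -
  let ?v = "Q_recip l"
  have r01: "0 < r" "r < 1" using r by (auto simp: admissible_radii_def)
  obtain \<omega> where om: "\<omega> holomorphic_on ball 0 1" "\<omega> 0 = 0"
    and om1: "\<And>z. z \<in> ball 0 1 \<Longrightarrow> norm (\<omega> z) < 1"
    and sub: "\<And>z. z \<in> ball 0 1 \<Longrightarrow> Q_fun l (of_real r * z) = P_fun l (of_real r * \<omega> z)"
    using r unfolding admissible_radii_def subordinate_def by blast
  have schwarz: "norm (\<omega> z) \<le> norm z" if "z \<in> ball 0 1" for z
    by (rule Schwarz_Lemma(1)[OF om]) (use that om1 in auto)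
  have ne1: "of_real r * \<zeta> \<noteq> 1" if "norm \<zeta> < 1" for \<zeta> :: complex
  proof
    assume "of_real r * \<zeta> = 1"
    then have "r * norm \<zeta> = 1" using r01 by (metis abs_of_pos norm_mult norm_of_real norm_one)
    moreover have "r * norm \<zeta> < 1 * 1" using r01 that by (intro mult_strict_mono) auto
    ultimately show False by simp
  qed
  have bound: "norm (1 / ?v x - 1) \<le> norm x * norm (1 / ?v x + cis (2 * l))" if x: "x \<in> ball 0 r" for x
  proof -
    define z where "z = x / of_real r"
    have z: "z \<in> ball 0 1" "x = of_real r * z" using x r01 by (auto simp: z_def norm_divide)
    have "norm (1 / ?v x - 1) = norm (of_real r * \<omega> z) * norm (1 / ?v x + cis (2 * l))"
      unfolding Q_fun_eq[symmetric] z(2) sub[OF z(1)]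
      by (subst P_fun_ratio(1)[OF ne1[OF om1[OF z(1)]]]) (simp only: norm_mult)
    also have "norm (of_real r * \<omega> z) \<le> norm x"
      using schwarz[OF z(1)] r01 unfolding z(2) by (simp add: norm_mult)
    finally show ?thesis by (simp add: mult_right_mono)
  qed
  show "norm (1 / ?v w - 1) \<le> norm w * norm (1 / ?v w + cis (2 * l))" by (rule bound[OF w])
  show "?v w \<noteq> 0"
  proof
    assume "?v w = 0"
    then have "norm w \<ge> 1" using bound[OF w] by simp
    then show False using w r01 by simp
  qed
  show "deriv ?v w \<noteq> 0"
  proof (cases "w = 0")
    case True
    then show ?thesis using one_plus_cis_double_nonzero[OF l] by (simp add: deriv_Q_recip_0 del: minus_add_distrib)
  next
    case False
    show ?thesis
    proof
      assume d0: "deriv ?v w = 0"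
      define z where "z = w / of_real r"
      have z: "z \<in> ball 0 1" "w = of_real r * z" "z \<noteq> 0" using w r01 False by (auto simp: z_def norm_divide)
      have wb: "w \<in> ball 0 1" using w r01 by simp
      have "?v w * P_fun l w = 1" using Q_recip_riccati(2)[OF wb, of l] d0 by simp
      then have "Q_fun l w = P_fun l w" unfolding Q_fun_eq by (metis div_by_0 mult_zero_left nonzero_eq_divide_eq mult.commute zero_neq_one)
      then have eq: "P_fun l (of_real r * \<omega> z) = P_fun l w" using sub[OF z(1)] z(2) by simp
      have w1: "w \<noteq> 1" using wb by auto
      have "(1 + cis (2 * l)) / (1 - of_real r * \<omega> z) = (1 + cis (2 * l)) / (1 - w)"
        using P_fun_ratio(2)[OF ne1[OF om1[OF z(1)]], of l] P_fun_ratio(2)[OF w1, of l] eq by metis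
      then have "of_real r * \<omega> z = w"
        using one_plus_cis_double_nonzero[OF l] ne1[OF om1[OF z(1)]] w1 by (auto simp: divide_simps)
      then have omz: "\<omega> z = z" using z(2) r01 by simp
      then have "\<exists>z. norm z < 1 \<and> z \<noteq> 0 \<and> norm (\<omega> z) = norm z" using z by auto
      then obtain \<alpha> where al: "\<And>z. norm z < 1 \<Longrightarrow> \<omega> z = \<alpha> * z"
        using Schwarz_Lemma(3)[OF om, of 0] om1 by auto
      have "\<alpha> = 1" using al[of z] z omz by simp
      then have id: "\<omega> x = x" if "norm x < 1" for x using al that by simp
      have dz: "deriv ?v x = 0" if x: "x \<in> ball 0 r - {0}" for x
      proof -
        have x': "norm (x / of_real r) < 1" using x r01 by (simp add: norm_divide)
        have "1 / ?v x = P_fun l x"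
          using sub[of "x / of_real r"] id[OF x'] x' r01 by (simp add: Q_fun_eq)
        moreover have xb: "x \<in> ball 0 1" using x r01 by simp
        moreover have "?v x \<noteq> 0"
        proof
          assume "?v x = 0"
          then have "norm x \<ge> 1" using bound[of x] x by simp
          then show False using xb by simp
        qed
        ultimately have "?v x * P_fun l x = 1" by (metis nonzero_mult_div_cancel_left times_divide_eq_right mult_1_right)
        then show ?thesis using Q_recip_riccati(2)[OF xb, of l] x by simp
      qed
      have "continuous_on (ball 0 1) (deriv ?v)"
        by (intro holomorphic_on_imp_continuous_on holomorphic_deriv Q_recip_riccati(1)) auto
      then have "deriv ?v \<midarrow>0\<rightarrow> deriv ?v 0" by (simp add: continuous_on_eq_continuous_at isCont_def)
      moreover have "eventually (\<lambda>x. deriv ?v x = 0) (at 0)"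
        unfolding eventually_at_topological using dz r01 by (intro exI[of _ "ball 0 r"]) auto
      then have "deriv ?v \<midarrow>0\<rightarrow> 0" by (rule tendsto_eventually)
      ultimately have "deriv ?v 0 = 0" by (rule LIM_unique)
      then show False using one_plus_cis_double_nonzero[OF l] by (simp add: deriv_Q_recip_0 del: minus_add_distrib)
    qed
  qed
qed

text \<open>Without this, the supremum defining \<open>R1\<close> would be unspecified.  The only candidate for the inner
  function is \<open>\<kappa> = (Q - 1) / (Q + \<mu>)\<close>, rescaled, with \<open>Q = Q_fun l\<close> and \<open>\<mu> = cis (2 l)\<close>.  Since \<open>Q - 1\<close> has half the first
  Taylor coefficient of \<open>P_fun l - 1\<close>, one has \<open>\<kappa>'(0) = 1/2\<close>, hence \<open>|\<kappa> z| < |z|\<close> near \<open>0\<close>.\<close>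

lemma admissible_radii_nonempty:
  assumes l: "cos l > 0"
  shows "admissible_radii l \<noteq> {}"
proof -
  let ?v = "Q_recip l"
  define \<mu> where "\<mu> = cis (2 * l)"
  have mu1: "1 + \<mu> \<noteq> 0" using one_plus_cis_double_nonzero[OF l] by (simp add: \<mu>_def)
  define \<kappa> where "\<kappa> = (\<lambda>z. (1 - ?v z) / (1 + \<mu> * ?v z))"
  note vh = Q_recip_riccati(1)[of l]
  have v1: "(?v has_field_derivative deriv ?v 0) (at 0)" using vh by (simp add: holomorphic_derivI)
  then have "(\<kappa> has_field_derivative - deriv ?v 0 / (1 + \<mu>)) (at 0)"
    unfolding \<kappa>_def using mu1
    by (auto intro!: derivative_eq_intros simp: Q_recip_0 power2_eq_square)
  moreover have "- deriv ?v 0 / (1 + \<mu>) = 1 / 2"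
  proof -
    have "- (- c / 2) / c = 1 / 2" if "c \<noteq> 0" for c :: complex using that by simp
    from this[OF mu1] show ?thesis unfolding deriv_Q_recip_0 \<mu>_def[symmetric] .
  qed
  ultimately have "(\<kappa> has_field_derivative 1 / 2) (at 0)" by (simp only:)
  then have "((\<lambda>h. (\<kappa> (0 + h) - \<kappa> 0) / h) \<longlongrightarrow> 1 / 2) (at 0)" unfolding DERIV_def .
  then have "((\<lambda>h. norm ((\<kappa> (0 + h) - \<kappa> 0) / h)) \<longlongrightarrow> norm (1 / 2 :: complex)) (at 0)" by (rule tendsto_norm)
  then have "eventually (\<lambda>h. norm ((\<kappa> (0 + h) - \<kappa> 0) / h) < 1) (at 0)"
    by (rule order_tendstoD(2)) simp
  moreover have "\<kappa> 0 = 0" by (simp add: \<kappa>_def Q_recip_0)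
  ultimately have "eventually (\<lambda>h. norm (\<kappa> h / h) < 1) (at 0)" by simp
  then obtain d1 where d1: "d1 > 0" and d1': "\<And>h. h \<noteq> 0 \<Longrightarrow> norm h < d1 \<Longrightarrow> norm (\<kappa> h / h) < 1"
    unfolding eventually_at by auto
  have kappa_lt: "norm (\<kappa> h) < norm h" if "h \<noteq> 0" "norm h < d1" for h
    using d1'[OF that] that(1) by (simp add: norm_divide)
  have cv: "isCont ?v 0" using v1 by (rule DERIV_isCont)
  then have "isCont (\<lambda>z. 1 + \<mu> * ?v z) 0" by (intro continuous_intros)
  then obtain d2 where d2: "d2 > 0" "\<And>z. norm z < d2 \<Longrightarrow> 1 + \<mu> * ?v z \<noteq> 0"
    using continuous_at_avoid[of 0 "\<lambda>z. 1 + \<mu> * ?v z" 0] mu1 by (auto simp: Q_recip_0)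
  obtain d3 where d3: "d3 > 0" "\<And>z. norm z < d3 \<Longrightarrow> ?v z \<noteq> 0"
    using continuous_at_avoid[OF cv, of 0] by (auto simp: Q_recip_0)
  define r where "r = Min {d1, d2, d3, 1 / 2}"
  have r: "0 < r" "r \<le> d1" "r \<le> d2" "r \<le> d3" "r < 1"
    using d1 d2(1) d3(1) by (auto simp: r_def)
  define \<omega> where "\<omega> = (\<lambda>z. \<kappa> (of_real r * z) / of_real r)"
  have rz: "norm (of_real r * z) < r" if "z \<in> ball 0 1" for z :: complex
    using that r by (simp add: norm_mult)
  have vr: "(\<lambda>z. ?v (of_real r * z)) holomorphic_on ball 0 1"
    by (rule holomorphic_on_compose_gen[unfolded o_def, OF _ vh])
      (use rz r in \<open>force intro!: holomorphic_intros\<close>)+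
  have avoid: "?v (of_real r * z) \<noteq> 0" "1 + \<mu> * ?v (of_real r * z) \<noteq> 0" "1 - of_real r * z \<noteq> 0"
    if "z \<in> ball 0 1" for z
    using d2(2) d3(2) rz[OF that] r by (force, force, auto)
  have "(\<lambda>z. Q_fun l (of_real r * z)) holomorphic_on ball 0 1"
    unfolding Q_fun_eq by (intro holomorphic_intros vr) (use avoid in auto)
  moreover have "(\<lambda>z. P_fun l (of_real r * z)) holomorphic_on ball 0 1"
    unfolding P_fun_def by (intro holomorphic_intros) (use avoid in auto)
  moreover have "\<omega> holomorphic_on ball 0 1"
    unfolding \<omega>_def \<kappa>_def by (intro holomorphic_intros vr) (use avoid r in auto)
  moreover have "\<omega> 0 = 0" by (simp add: \<omega>_def \<kappa>_def Q_recip_0)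
  moreover have "norm (\<omega> z) < 1 \<and> Q_fun l (of_real r * z) = P_fun l (of_real r * \<omega> z)"
    if z: "z \<in> ball 0 1" for z
  proof
    show "norm (\<omega> z) < 1"
    proof (cases "z = 0")
      case True
      then show ?thesis by (simp add: \<omega>_def \<kappa>_def Q_recip_0)
    next
      case False
      then have "norm (\<kappa> (of_real r * z)) < r"
        using kappa_lt[of "of_real r * z"] rz[OF z] r by simp
      then show ?thesis using r by (simp add: \<omega>_def norm_divide)
    qed
    define x where "x = ?v (of_real r * z)"
    have x: "x \<noteq> 0" "1 + \<mu> * x \<noteq> 0" using avoid[OF z] by (auto simp: x_def)
    have "of_real r * \<omega> z = (1 - x) / (1 + \<mu> * x)" using r by (simp add: \<omega>_def \<kappa>_def x_def)
    moreover have "1 + \<mu> * ((1 - x) / (1 + \<mu> * x)) = (1 + \<mu>) / (1 + \<mu> * x)"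
      "1 - (1 - x) / (1 + \<mu> * x) = x * (1 + \<mu>) / (1 + \<mu> * x)"
      using x(2) by (simp_all add: divide_simps) (simp_all add: algebra_simps)
    ultimately have "P_fun l (of_real r * \<omega> z) = 1 / x"
      using x mu1 by (simp add: P_fun_def \<mu>_def[symmetric])
    then show "Q_fun l (of_real r * z) = P_fun l (of_real r * \<omega> z)" by (simp add: Q_fun_eq x_def)
  qed
  ultimately have "r \<in> admissible_radii l"
    using r unfolding admissible_radii_def subordinate_def by blast
  then show ?thesis by blast
qed

text \<open>Lifting \<open>u = f / (z f')\<close> through \<open>Q_recip l\<close> gives \<open>starlike_fun f z = Q_fun l (\<phi> z)\<close> with
  \<open>|\<phi> z| \<le> |z|\<close>, a value in an Apollonius disc inside the half-plane.  In particular \<open>u\<close> has no zero.\<close>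

lemma admissible_radius_spirallike:
  assumes l: "cos l > 0" and r: "r \<in> admissible_radii l" and f: "f \<in> Robertson l"
  shows "starlike_fun f holomorphic_on ball 0 r"
    and "\<And>z. z \<in> ball 0 r \<Longrightarrow> Re (cis (- l) * starlike_fun f z) > 0"
proof -
  have r01: "0 < r" "r < 1" using r by (auto simp: admissible_radii_def)
  have sub: "ball 0 r \<subseteq> ball (0::complex) 1" using r01 by auto
  obtain u where u: "u holomorphic_on ball 0 1" "u 0 = 1"
    and ode: "\<And>z. z \<in> ball 0 1 \<Longrightarrow> z * deriv u z = 1 - u z * convexity_fun f z"
    and star: "\<And>z. starlike_fun f z = 1 / u z"
    using Robertson_riccati[OF f] by blast
  note uh = holomorphic_on_subset[OF u(1) sub]
  have key: "u z \<noteq> 0 \<and> Re (cis (- l) * (1 / u z)) > 0" if z: "z \<in> ball 0 r" for z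
  proof -
    obtain R where R: "norm z < R" "R < r" using z dense by auto
    have R0: "0 < R" using R(1) norm_ge_zero[of z] by linarith
    obtain \<phi> where phi: "\<And>z. z \<in> ball 0 R \<Longrightarrow> norm (\<phi> z) \<le> norm z"
      "\<And>z. z \<in> ball 0 R \<Longrightarrow> Q_recip l (\<phi> z) = u z"
    proof (rule riccati_subordination[OF l _ R0 R(2) _ _ _ _ _ uh])
      show "Q_recip l holomorphic_on ball 0 r" by (rule holomorphic_on_subset[OF Q_recip_riccati(1) sub])
      show "Q_recip l 0 = u 0" by (simp add: Q_recip_0 u(2))
      show "z * deriv u z = 1 - u z * convexity_fun f z" if "z \<in> ball 0 r" for z
        by (rule ode) (use that sub in auto)
      show "norm (convexity_fun f z - 1) \<le> norm z * norm (convexity_fun f z + cis (2 * l))"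
        if "z \<in> ball 0 r" for z
        by (rule Robertson_disc_bound[OF f l]) (use that sub in auto)
      show "w * deriv (Q_recip l) w = 1 - Q_recip l w * P_fun l w" if "w \<in> ball 0 r" for w
        by (rule Q_recip_riccati(2)) (use that sub in auto)
    qed (use r01 admissible_radius_bounds[OF l r] in auto)
    have zR: "z \<in> ball 0 R" using R by simp
    have pz: "\<phi> z \<in> ball 0 r" "norm (\<phi> z) < 1" using phi(1)[OF zR] z r01 by auto
    note b = admissible_radius_bounds[OF l r pz(1), unfolded phi(2)[OF zR]]
    show ?thesis using disc_imp_half_plane[OF l pz(2) b(1)] b(2) by simp
  qed
  have eq: "starlike_fun f = (\<lambda>z. 1 / u z)" using star by auto
  show "starlike_fun f holomorphic_on ball 0 r"
    unfolding eq by (intro holomorphic_intros uh) (use key in auto)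
  show "Re (cis (- l) * starlike_fun f z) > 0" if "z \<in> ball 0 r" for z
    using key[OF that] unfolding eq by simp
qed

theorem mainTheorem5:
  fixes l :: real
  assumes "- pi / 2 < l" and "l < pi / 2"
  shows "R1 l \<le> spirallike_radius l \<and>
         (\<forall>f\<in>Robertson l. \<forall>z. norm z < R1 l \<longrightarrow> Re (cis (- l) * starlike_fun f z) > 0)"
proof
  have l: "cos l > 0" using assms by (intro cos_gt_zero_pi) auto
  have R1: "R1 l = Sup (admissible_radii l)" by (simp add: R1_def admissible_radii_def)
  note ne = admissible_radii_nonempty[OF l]
  show "R1 l \<le> spirallike_radius l"
    unfolding R1 spirallike_radius_def
  proof (rule cSup_subset_mono[OF ne])
    show "bdd_above {r. 0 < r \<and> r \<le> 1 \<and> (\<forall>f\<in>Robertson l. starlike_fun f holomorphic_on ball 0 r \<and>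
               (\<forall>z\<in>ball 0 r. Re (cis (- l) * starlike_fun f z) > 0))}"
      by (rule bdd_aboveI[of _ 1]) auto
    show "admissible_radii l \<subseteq> {r. 0 < r \<and> r \<le> 1 \<and> (\<forall>f\<in>Robertson l. starlike_fun f holomorphic_on ball 0 r \<and>
               (\<forall>z\<in>ball 0 r. Re (cis (- l) * starlike_fun f z) > 0))}"
      using admissible_radius_spirallike[OF l] by (auto simp: admissible_radii_def)
  qed
  show "\<forall>f\<in>Robertson l. \<forall>z. norm z < R1 l \<longrightarrow> Re (cis (- l) * starlike_fun f z) > 0"
  proof (intro ballI allI impI)
    fix f z assume f: "f \<in> Robertson l" and z: "norm (z::complex) < R1 l"
    obtain r where "r \<in> admissible_radii l" "norm z < r"
      using less_cSupE[OF z[unfolded R1] ne] by blast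
    then show "Re (cis (- l) * starlike_fun f z) > 0"
      using admissible_radius_spirallike(2)[OF l _ f] by simp
  qed
qed

end
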